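(* Let $S$ be a numerical semigroup with multiplicity $m$, minimal generators $m<n_1<\dots<n_k$, Kunz poset $P$ and Kunz nilsemigroup $N$ with atoms $p_i=n_i \bmod m$. Write $\mathrm{Ap}(S;m)=\{0,a_1,\dots,a_{m-1}\}$ with $a_i\equiv i \pmod m$. Then for each $i$, \[ \mathsf Z_S(a_i)=\{(0,z_1,\dots,z_k): (z_1,\dots,z_k)\in\mathsf Z_P(i)\}. \] Moreover, for any minimal presentation $\rho$ of $S$, the set \[ \{((z_1,\dots,z_k),(z_1',\dots,z_k')) : (z,z')\in\rho \text{ with } \varphi_S(z)\in\mathrm{Ap}(S;m)\} \] is a minimal presentation of $P$.
   Context: A numerical semigroup is a cofinite submonoid $S$ of $(\mathbb Z_{\ge0},+)$; its multiplicity $m$ is its smallest positive element. The Apéry set is $\mathrm{Ap}(S;m)=\{n\in S: n-m\notin S\}$; it contains exactly one element $a_i$ with $a_i\equiv i\pmod m$ for each $i\in\mathbb Z_m$, and $a_0=0$. The Kunz poset $P$ of $S$ is $\mathbb Z_m$ ordered by $i\preceq j$ iff $a_j-a_i\in\mathrm{Ap}(S;m)$. The Kunz nilsemigroup of $S$ is $N=\mathbb Z_m\cup\{\infty\}$ with $\infty$ absorbing and $i\oplus j=i+j$ if $a_i+a_j=a_{i+j}$, and $i\oplus j=\infty$ otherwise. The atoms of $P$ (elements covering $0$) are exactly the classes $p_i=n_i\bmod m$ of the minimal generators $n_1,\dots,n_k$ of $S$ other than $m$. Factorizations of $S$: $\mathsf Z_S(n)=\{z=(z_0,\dots,z_k)\in\mathbb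 Z_{\ge0}^{k+1}: n=z_0m+z_1n_1+\dots+z_kn_k\}$ and $\varphi_S(z)=z_0m+\sum_{i\ge1}z_in_i$. The kernel $\ker\varphi_S=\{(z,z'):\varphi_S(z)=\varphi_S(z')\}$ is a congruence on $\mathbb Z_{\ge0}^{k+1}$ (an equivalence relation with $z\sim z'\Rightarrow z+w\sim z'+w$). A presentation of $S$ is a subset $\rho\subseteq\ker\varphi_S$ such that $\ker\varphi_S$ is the smallest congruence containing $\rho$; it is minimal if minimal under inclusion among presentations. Factorizations of $P$: for $u\in N$, $\mathsf Z_P(u)=\{z\in\mathbb Z_{\ge0}^k: z_1p_1\oplus\dots\oplus z_kp_k=u\}$ (computed in $N$), and $\varphi_P:\mathbb Z_{\ge0}^k\to N$ sends $z$ to this sum. A minimal presentation of $P$ is a set obtained from a minimal (under inclusion) generating set of the congruence $\ker\varphi_P$ on $\mathbb Z_{\ge0}^k$ by deleting all pairs $(z,z')$ with $\varphi_P(z)=\infty$. *)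

theory Defs
  imports "HOL-Algebra.FiniteProduct"
begin

section \<open>Numerical semigroups\<close>

definition nat_add :: "nat monoid" where
  "nat_add = \<lparr>carrier = UNIV, mult = (+), one = 0\<rparr>"

definition numerical_semigroup :: "nat set \<Rightarrow> bool" where
  "numerical_semigroup S \<longleftrightarrow> submonoid S nat_add \<and> finite (- S)"

definition smallest_positive :: "nat set \<Rightarrow> nat" where
  "smallest_positive S = (LEAST n. n \<in> S \<and> 0 < n)"

definition generates_submonoid :: "nat set \<Rightarrow> nat set \<Rightarrow> bool" where
  "generates_submonoid G S \<longleftrightarrow>
     submonoid S nat_add \<and> G \<subseteq> S \<and> (\<forall>T. submonoid T nat_add \<and> G \<subseteq> T \<longrightarrow> S \<subseteq> T)"

definition minimal_generators :: "nat set \<Rightarrow> nat set \<Rightarrow> bool" where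
  "minimal_generators G S \<longleftrightarrow>
     generates_submonoid G S \<and> (\<forall>H. H \<subset> G \<longrightarrow> \<not> generates_submonoid H S)"

text \<open>Subtraction on \<^typ>\<open>nat\<close> truncates, hence the guards of the form \<open>m \<le> n\<close> below.\<close>

definition apery :: "nat set \<Rightarrow> nat \<Rightarrow> nat set" where
  "apery S m = {n \<in> S. \<not> (m \<le> n \<and> n - m \<in> S)}"

definition apery_elem :: "nat set \<Rightarrow> nat \<Rightarrow> nat \<Rightarrow> nat" where
  "apery_elem S m i = (THE n. n \<in> apery S m \<and> n mod m = i mod m)"


section \<open>Kunz poset and Kunz nilsemigroup\<close>

text \<open>The group of integers modulo \<open>m\<close> is represented by the residues \<open>{..<m}\<close>.\<close>

definition kunz_le :: "nat set \<Rightarrow> nat \<Rightarrow> nat \<Rightarrow> nat \<Rightarrow> bool" where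
  "kunz_le S m i j \<longleftrightarrow>
     apery_elem S m i \<le> apery_elem S m j \<and> apery_elem S m j - apery_elem S m i \<in> apery S m"

definition kunz_less :: "nat set \<Rightarrow> nat \<Rightarrow> nat \<Rightarrow> nat \<Rightarrow> bool" where
  "kunz_less S m i j \<longleftrightarrow> kunz_le S m i j \<and> i \<noteq> j"

definition kunz_atoms :: "nat set \<Rightarrow> nat \<Rightarrow> nat set" where
  "kunz_atoms S m = {p \<in> {..<m}. kunz_less S m 0 p \<and>
     \<not> (\<exists>q\<in>{..<m}. kunz_less S m 0 q \<and> kunz_less S m q p)}"

fun kunz_add :: "nat set \<Rightarrow> nat \<Rightarrow> nat option \<Rightarrow> nat option \<Rightarrow> nat option" where
  "kunz_add S m (Some i) (Some j) =
     (if apery_elem S m i + apery_elem S m j = apery_elem S m ((i + j) mod m)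
      then Some ((i + j) mod m) else None)"
| "kunz_add S m _ _ = None"

text \<open>\<^const>\<open>None\<close> is the absorbing element \<open>\<infinity>\<close>.  The operation is written
  additively in the mathematics; in terms of the monoid record, \<open>z\<close> copies of \<open>p\<close> add up
  to \<open>p [^] z\<close>, and sums are \<^const>\<open>finprod\<close>.\<close>

definition kunz_nilsemigroup :: "nat set \<Rightarrow> nat \<Rightarrow> nat option monoid" where
  "kunz_nilsemigroup S m =
     \<lparr>carrier = insert None (Some ` {..<m}), mult = kunz_add S m, one = Some 0\<rparr>"


section \<open>Congruences on vectors of natural numbers\<close>

definition nvec :: "nat \<Rightarrow> nat list set" where
  "nvec d = {z. length z = d}"

definition nvec_add :: "nat list \<Rightarrow> nat list \<Rightarrow> nat list" where
  "nvec_add z w = map2 (+) z w"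

definition congruence :: "nat \<Rightarrow> (nat list \<times> nat list) set \<Rightarrow> bool" where
  "congruence d R \<longleftrightarrow> equiv (nvec d) R \<and>
     (\<forall>z z' w. (z, z') \<in> R \<and> w \<in> nvec d \<longrightarrow> (nvec_add z w, nvec_add z' w) \<in> R)"

definition generates_congruence ::
    "nat \<Rightarrow> (nat list \<times> nat list) set \<Rightarrow> (nat list \<times> nat list) set \<Rightarrow> bool" where
  "generates_congruence d \<rho> R \<longleftrightarrow>
     congruence d R \<and> \<rho> \<subseteq> R \<and> (\<forall>R'. congruence d R' \<and> \<rho> \<subseteq> R' \<longrightarrow> R \<subseteq> R')"

definition minimally_generates_congruence ::
    "nat \<Rightarrow> (nat list \<times> nat list) set \<Rightarrow> (nat list \<times> nat list) set \<Rightarrow> bool" where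
  "minimally_generates_congruence d \<rho> R \<longleftrightarrow>
     generates_congruence d \<rho> R \<and> (\<forall>\<sigma>. \<sigma> \<subset> \<rho> \<longrightarrow> \<not> generates_congruence d \<sigma> R)"

definition kernel :: "nat \<Rightarrow> (nat list \<Rightarrow> 'a) \<Rightarrow> (nat list \<times> nat list) set" where
  "kernel d f = {(z, z'). z \<in> nvec d \<and> z' \<in> nvec d \<and> f z = f z'}"


section \<open>Factorizations and presentations\<close>

text \<open>For a semigroup, \<open>gs\<close> lists all generators, so \<open>gs = [m, n\<^sub>1, \<dots>, n\<^sub>k]\<close>;
  for a Kunz poset, \<open>ps\<close> lists the atoms \<open>[p\<^sub>1, \<dots>, p\<^sub>k]\<close>.\<close>

definition phi_S :: "nat list \<Rightarrow> nat list \<Rightarrow> nat" where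
  "phi_S gs z = (\<Sum>i<length gs. z ! i * gs ! i)"

definition factorizations_S :: "nat list \<Rightarrow> nat \<Rightarrow> nat list set" where
  "factorizations_S gs n = {z \<in> nvec (length gs). n = phi_S gs z}"

definition minimal_presentation_S :: "nat list \<Rightarrow> (nat list \<times> nat list) set \<Rightarrow> bool" where
  "minimal_presentation_S gs \<rho> \<longleftrightarrow>
     minimally_generates_congruence (length gs) \<rho> (kernel (length gs) (phi_S gs))"

definition phi_P :: "nat set \<Rightarrow> nat \<Rightarrow> nat list \<Rightarrow> nat list \<Rightarrow> nat option" where
  "phi_P S m ps z =
     finprod (kunz_nilsemigroup S m)
       (\<lambda>i. Some (ps ! i) [^]\<^bsub>kunz_nilsemigroup S m\<^esub> (z ! i)) {..<length ps}"

definition factorizations_P ::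
    "nat set \<Rightarrow> nat \<Rightarrow> nat list \<Rightarrow> nat option \<Rightarrow> nat list set" where
  "factorizations_P S m ps u = {z \<in> nvec (length ps). phi_P S m ps z = u}"

definition minimal_presentation_P ::
    "nat set \<Rightarrow> nat \<Rightarrow> nat list \<Rightarrow> (nat list \<times> nat list) set \<Rightarrow> bool" where
  "minimal_presentation_P S m ps \<rho> \<longleftrightarrow>
     (\<exists>\<sigma>. minimally_generates_congruence (length ps) \<sigma> (kernel (length ps) (phi_P S m ps)) \<and>
          \<rho> = {(z, z') \<in> \<sigma>. phi_P S m ps z \<noteq> None})"


section \<open>The definitions are well behaved\<close>

lemma submonoid_nat_add_iff:
  "submonoid S nat_add \<longleftrightarrow> 0 \<in> S \<and> (\<forall>x\<in>S. \<forall>y\<in>S. x + y \<in> S)"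
  by (auto simp: submonoid_def nat_add_def)

lemma generates_submonoid_iff:
  "generates_submonoid G S \<longleftrightarrow> S = \<Inter>{T. submonoid T nat_add \<and> G \<subseteq> T}"
  unfolding generates_submonoid_def submonoid_nat_add_iff by (rule iffI, blast) auto

lemma smallest_positive:
  assumes "numerical_semigroup S"
  shows "smallest_positive S \<in> S" "0 < smallest_positive S"
proof -
  have "infinite (S - {0})"
  proof
    assume "finite (S - {0})"
    then have "finite ((- S) \<union> (S - {0}) \<union> {0})"
      using assms by (simp add: numerical_semigroup_def)
    moreover have "(- S) \<union> (S - {0}) \<union> {0} = UNIV" by auto
    ultimately have "finite (UNIV :: nat set)" by metis
    then show False by simp
  qed
  then obtain n where "n \<in> S \<and> 0 < n"
    by (metis Diff_iff finite.emptyI ex_in_conv gr0I singletonI)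
  from LeastI[of "\<lambda>n. n \<in> S \<and> 0 < n", OF this]
  show "smallest_positive S \<in> S" "0 < smallest_positive S"
    by (auto simp: smallest_positive_def)
qed

context
  fixes S :: "nat set" and m :: nat
  assumes S: "numerical_semigroup S" and m_def: "m = smallest_positive S"
begin

lemma m_pos: "0 < m" and m_in: "m \<in> S"
  using smallest_positive[OF S] m_def by auto

lemma S_zero: "0 \<in> S" and S_add: "x \<in> S \<Longrightarrow> y \<in> S \<Longrightarrow> x + y \<in> S"
  using S by (auto simp: numerical_semigroup_def submonoid_nat_add_iff)

lemma S_add_mult: "x \<in> S \<Longrightarrow> x + c * m \<in> S"
proof (induction c)
  case (Suc c)
  then show ?case using S_add[OF Suc.IH m_in] by (simp add: algebra_simps)
qed simp

lemma apery_unique: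
  assumes "x \<in> apery S m" "y \<in> S" "x mod m = y mod m" shows "x \<le> y"
proof (rule ccontr)
  assume "\<not> x \<le> y"
  then have "y < x" by simp
  with assms(3) have "m dvd x - y" by (simp add: mod_eq_dvd_iff_nat)
  then obtain c where "x - y = m * c" by (auto simp: dvd_def)
  with \<open>y < x\<close> have c: "x = y + m * c" by simp
  with \<open>y < x\<close> obtain d where "c = Suc d" by (cases c) auto
  with c have "m \<le> x" "x - m = y + d * m" by (auto simp: algebra_simps)
  then show False using assms(1) S_add_mult[OF assms(2)] by (auto simp: apery_def)
qed

lemma apery_ex1: "\<exists>!n. n \<in> apery S m \<and> n mod m = i mod m"
proof -
  have "\<exists>n. n \<in> S \<and> n mod m = i mod m"
  proof (rule ccontr)
    assume none: "\<not> ?thesis"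
    have "range (\<lambda>c. i + c * m) \<subseteq> - S" using none by auto
    moreover have "inj (\<lambda>c. i + c * m)" using m_pos by (auto simp: inj_on_def)
    then have "infinite (range (\<lambda>c. i + c * m))" by (simp add: finite_image_iff)
    ultimately show False using S finite_subset unfolding numerical_semigroup_def by blast
  qed
  then obtain n where n: "n \<in> S \<and> n mod m = i mod m"
    and least: "\<And>l. l < n \<Longrightarrow> \<not> (l \<in> S \<and> l mod m = i mod m)"
    using exists_least_iff[of "\<lambda>n. n \<in> S \<and> n mod m = i mod m"] by blast
  have "n \<in> apery S m"
    using n least[of "n - m"] m_pos by (auto simp: apery_def le_mod_geq)
  with n have "n \<in> apery S m \<and> n mod m = i mod m" by simp
  moreover have "x = n" if "x \<in> apery S m \<and> x mod m = i mod m" for x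
    using apery_unique[of x n] apery_unique[of n x] that calculation
    by (auto simp: apery_def)
  ultimately show ?thesis by blast
qed

lemma apery_elem: "apery_elem S m i \<in> apery S m" "apery_elem S m i mod m = i mod m"
  using theI'[OF apery_ex1[of i]] by (auto simp: apery_elem_def)

lemma apery_elem_in_S: "apery_elem S m i \<in> S"
  using apery_elem(1)[of i] by (simp add: apery_def)

lemma apery_elem_eqI: "n \<in> apery S m \<Longrightarrow> n mod m = i mod m \<Longrightarrow> apery_elem S m i = n"
  using apery_elem[of i] apery_ex1[of i] by blast

lemma zero_in_apery: "0 \<in> apery S m"
  using S_zero m_pos by (simp add: apery_def)

lemma apery_elem_zero: "apery_elem S m 0 = 0"
  by (rule apery_elem_eqI[OF zero_in_apery]) simp

lemma apery_elem_subadd: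
  "apery_elem S m ((i + j) mod m) \<le> apery_elem S m i + apery_elem S m j"
proof (rule apery_unique[OF apery_elem(1) S_add[OF apery_elem_in_S apery_elem_in_S]])
  have "(apery_elem S m i + apery_elem S m j) mod m = (i + j) mod m"
    by (rule mod_add_cong) (rule apery_elem(2))+
  then show "apery_elem S m ((i + j) mod m) mod m = (apery_elem S m i + apery_elem S m j) mod m"
    using apery_elem(2)[of "(i + j) mod m"] by simp
qed

lemma apery_summand: "x + y \<in> apery S m \<Longrightarrow> x \<in> S \<Longrightarrow> y \<in> S \<Longrightarrow> x \<in> apery S m"
  using S_add[of "x - m" y] by (auto simp: apery_def)

lemma kunz_add_commute: "kunz_add S m u v = kunz_add S m v u"
  by (cases u; cases v) (auto simp: add.commute)

lemma kunz_add_assoc_Some: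
  "kunz_add S m (kunz_add S m (Some i) (Some j)) (Some l) =
     (if apery_elem S m i + apery_elem S m j + apery_elem S m l
         = apery_elem S m ((i + j + l) mod m)
      then Some ((i + j + l) mod m) else None)"
  using apery_elem_subadd[of i j] apery_elem_subadd[of "(i + j) mod m" l]
  by (auto simp: mod_add_left_eq)

lemma kunz_add_assoc:
  "kunz_add S m (kunz_add S m u v) w = kunz_add S m u (kunz_add S m v w)"
proof (cases "u = None \<or> v = None \<or> w = None")
  case True
  then show ?thesis
    by (elim disjE) (cases u; cases v; cases w; simp)+
next
  case False
  then obtain i j l where "u = Some i" "v = Some j" "w = Some l" by auto
  then show ?thesis
    using kunz_add_assoc_Some[of i j l] kunz_add_assoc_Some[of j l i]
      kunz_add_commute[of u "kunz_add S m v w"]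
    by (simp add: ac_simps del: kunz_add.simps)
qed

lemma comm_monoid_kunz: "comm_monoid (kunz_nilsemigroup S m)"
proof (rule comm_monoidI)
  fix u v
  assume "u \<in> carrier (kunz_nilsemigroup S m)" "v \<in> carrier (kunz_nilsemigroup S m)"
  then show "u \<otimes>\<^bsub>kunz_nilsemigroup S m\<^esub> v \<in> carrier (kunz_nilsemigroup S m)"
    using m_pos by (cases u; cases v) (auto simp: kunz_nilsemigroup_def)
next
  fix u assume "u \<in> carrier (kunz_nilsemigroup S m)"
  then show "\<one>\<^bsub>kunz_nilsemigroup S m\<^esub> \<otimes>\<^bsub>kunz_nilsemigroup S m\<^esub> u = u"
    by (auto simp: kunz_nilsemigroup_def apery_elem_zero)
qed (auto simp: kunz_nilsemigroup_def m_pos kunz_add_assoc intro: kunz_add_commute)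

lemma minimal_generators_iff:
  assumes "minimal_generators G S"
  shows "n \<in> G \<longleftrightarrow> n \<in> S \<and> 0 < n \<and> (\<forall>x\<in>S. \<forall>y\<in>S. n = x + y \<longrightarrow> x = 0 \<or> y = 0)"
    (is "_ \<longleftrightarrow> ?irr")
proof
  have gen: "submonoid S nat_add" "G \<subseteq> S" "\<And>T. submonoid T nat_add \<Longrightarrow> G \<subseteq> T \<Longrightarrow> S \<subseteq> T"
    and min: "\<And>H. H \<subset> G \<Longrightarrow> \<not> generates_submonoid H S"
    using assms by (auto simp: minimal_generators_def generates_submonoid_def)
  have not_redundant: False
    if "n \<in> G" and red: "\<And>T. submonoid T nat_add \<Longrightarrow> G - {n} \<subseteq> T \<Longrightarrow> n \<in> T" for n
  proof -
    have "G - {n} \<subset> G" using that(1) by auto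
    then have "\<not> generates_submonoid (G - {n}) S" by (rule min)
    then obtain T where "submonoid T nat_add" "G - {n} \<subseteq> T" "\<not> S \<subseteq> T"
      using gen(1,2) unfolding generates_submonoid_def by blast
    then show False using gen(3)[of T] red[of T] by blast
  qed
  {
    assume n: "n \<in> G"
    have "0 < n"
    proof (rule ccontr)
      assume "\<not> 0 < n"
      then show False using not_redundant[OF n] by (simp add: submonoid_nat_add_iff)
    qed
    moreover have "x = 0 \<or> y = 0" if xy: "x \<in> S" "y \<in> S" "n = x + y" for x y
    proof (rule ccontr)
      assume "\<not> (x = 0 \<or> y = 0)"
      with xy(3) have less: "x < n" "y < n" by auto
      show False
      proof (rule not_redundant[OF n])
        fix T assume T: "submonoid T nat_add" "G - {n} \<subseteq> T"
        have "submonoid (T \<union> {n..}) nat_add" "G \<subseteq> T \<union> {n..}"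
          using T by (auto simp: submonoid_nat_add_iff)
        then have "S \<subseteq> T \<union> {n..}" by (rule gen(3))
        then have "x \<in> T" "y \<in> T" using xy(1,2) less by auto
        then show "n \<in> T" using T(1) xy(3) by (simp add: submonoid_nat_add_iff)
      qed
    qed
    ultimately show ?irr using n gen(2) by auto
  next
    assume irr: ?irr
    show "n \<in> G"
    proof (rule ccontr)
      assume "n \<notin> G"
      have "submonoid (S - {n}) nat_add"
        unfolding submonoid_nat_add_iff
      proof (intro conjI ballI)
        show "0 \<in> S - {n}" using irr S_zero by auto
        show "x + y \<in> S - {n}" if "x \<in> S - {n}" "y \<in> S - {n}" for x y
          using that irr S_add[of x y] by fastforce
      qed
      then have "S \<subseteq> S - {n}" using \<open>n \<notin> G\<close> gen(2,3) by blast
      then show False using irr by blast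
    qed
  }
qed

lemma kunz_less_zero: "q < m \<Longrightarrow> kunz_less S m 0 q \<longleftrightarrow> q \<noteq> 0"
  by (auto simp: kunz_less_def kunz_le_def apery_elem_zero apery_elem(1))

lemma kunz_atoms_eq:
  assumes G: "minimal_generators G S"
  shows "kunz_atoms S m = (\<lambda>n. n mod m) ` (G - {m})"
proof (intro equalityI subsetI)
  fix p assume "p \<in> kunz_atoms S m"
  then have p: "p < m" "p \<noteq> 0" and cov: "\<And>q. q < m \<Longrightarrow> q \<noteq> 0 \<Longrightarrow> \<not> kunz_less S m q p"
    by (auto simp: kunz_atoms_def kunz_less_zero) (auto simp: kunz_less_def)
  let ?n = "apery_elem S m p"
  have nm: "?n mod m = p" using apery_elem(2)[of p] p by simp
  have "?n \<in> G"
    unfolding minimal_generators_iff[OF G]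
  proof (intro conjI ballI impI)
    show "?n \<in> S" by (rule apery_elem_in_S)
    show "0 < ?n" using nm p by (cases "?n = 0") auto
    fix x y assume xy: "x \<in> S" "y \<in> S" "?n = x + y"
    have ap: "x \<in> apery S m" "y \<in> apery S m"
      using apery_summand[of x y] apery_summand[of y x] xy apery_elem(1)[of p]
      by (auto simp: add.commute)
    let ?q = "x mod m"
    have ax: "apery_elem S m ?q = x" by (rule apery_elem_eqI[OF ap(1)]) simp
    have le: "kunz_le S m ?q p" using ap(2) xy(3) by (simp add: kunz_le_def ax)
    show "x = 0 \<or> y = 0"
    proof (cases "?q = 0")
      case True
      then show ?thesis using ax apery_elem_zero by simp
    next
      case False
      then have "?q = p" using cov[of ?q] le m_pos by (auto simp: kunz_less_def)
      then show ?thesis using ax xy(3) by simp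
    qed
  qed
  moreover have "?n \<noteq> m" using nm p by auto
  ultimately show "p \<in> (\<lambda>n. n mod m) ` (G - {m})" using nm by (intro image_eqI[of _ _ ?n]) auto
next
  fix p assume "p \<in> (\<lambda>n. n mod m) ` (G - {m})"
  then obtain n where n: "n \<in> G" "n \<noteq> m" "p = n mod m" by auto
  then have irr: "n \<in> S" "0 < n" "\<And>x y. x \<in> S \<Longrightarrow> y \<in> S \<Longrightarrow> n = x + y \<Longrightarrow> x = 0 \<or> y = 0"
    using minimal_generators_iff[OF G, of n] by auto
  have "n \<in> apery S m"
    using irr(1) irr(3)[of m "n - m"] m_in m_pos n(2) by (auto simp: apery_def)
  then have an: "apery_elem S m p = n" using n(3) by (intro apery_elem_eqI) auto
  have "p < m" using n(3) m_pos by simp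
  moreover have "p \<noteq> 0" using an apery_elem_zero irr(2) by (cases "p = 0") auto
  moreover have "\<not> kunz_less S m q p" if q: "q < m" "q \<noteq> 0" for q
  proof
    assume "kunz_less S m q p"
    then have le: "apery_elem S m q \<le> n" "n - apery_elem S m q \<in> S" and "q \<noteq> p"
      by (auto simp: kunz_less_def kunz_le_def an apery_def)
    have "apery_elem S m q = 0 \<or> n - apery_elem S m q = 0"
      by (rule irr(3)) (use le apery_elem_in_S in auto)
    then have "apery_elem S m q = 0 \<or> apery_elem S m q = n" using le(1) by auto
    moreover have "apery_elem S m q mod m = q" using apery_elem(2)[of q] q by simp
    ultimately show False using q \<open>q \<noteq> p\<close> n(3) by auto
  qed
  ultimately show "p \<in> kunz_atoms S m" by (auto simp: kunz_atoms_def kunz_less_zero)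
qed

end

end

theory Submission
  imports Defs
begin

text \<open>
  The map sending \<open>x \<in> S\<close> to its residue if \<open>x\<close> is an Apery element and to \<open>\<infinity>\<close> otherwise is a
  homomorphism onto the Kunz nilsemigroup, so \<open>\<phi>\<^sub>P(z)\<close> is the image of \<open>\<phi>\<^sub>S(0, z)\<close>; since a
  factorization of an Apery element cannot use \<open>m\<close>, the two kernels agree away from \<open>\<infinity>\<close>.
  The class \<open>\<infinity>\<close> is an ideal, hence a relation inside it never affects the other classes.
  Congruences can therefore be transported between \<open>\<nat>\<^sup>k\<^sup>+\<^sup>1\<close> and \<open>\<nat>\<^sup>k\<close>, imposing the given relations
  on the Apery part only; this yields both generation and irredundancy of the Apery part of
  \<open>\<rho>\<close>. It remains to complete it to a minimal generating set by relations inside \<open>\<infinity>\<close>. There,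
  finitely many relations suffice, and a subset of least cardinality that still suffices is taken.
\<close>

section \<open>Vectors and congruences\<close>

lemma nvec_add_in [simp]: "z \<in> nvec d \<Longrightarrow> w \<in> nvec d \<Longrightarrow> nvec_add z w \<in> nvec d"
  by (simp add: nvec_def nvec_add_def)

lemma nvec_add_Cons [simp]: "nvec_add (a # z) (b # w) = (a + b) # nvec_add z w"
  by (simp add: nvec_add_def)

lemma nvec_SucE:
  assumes "z \<in> nvec (Suc d)" obtains c y where "z = c # y" "y \<in> nvec d"
  using assms by (auto simp: nvec_def length_Suc_conv)

lemma phi_S_add:
  assumes "z \<in> nvec (length gs)" "w \<in> nvec (length gs)"
  shows "phi_S gs (nvec_add z w) = phi_S gs z + phi_S gs w"
  using assms
  by (simp add: phi_S_def nvec_def nvec_add_def sum.distrib[symmetric] distrib_right)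

lemma phi_S_Cons [simp]: "phi_S (g # gs) (c # z) = c * g + phi_S gs z"
  by (simp add: phi_S_def sum.lessThan_Suc_shift del: sum.lessThan_Suc)

lemma congruenceI:
  assumes "R \<subseteq> nvec d \<times> nvec d"
    and "\<And>z. z \<in> nvec d \<Longrightarrow> (z, z) \<in> R"
    and "\<And>y z. (y, z) \<in> R \<Longrightarrow> (z, y) \<in> R"
    and "\<And>x y z. (x, y) \<in> R \<Longrightarrow> (y, z) \<in> R \<Longrightarrow> (x, z) \<in> R"
    and "\<And>z z' w. (z, z') \<in> R \<Longrightarrow> w \<in> nvec d \<Longrightarrow> (nvec_add z w, nvec_add z' w) \<in> R"
  shows "congruence d R"
  unfolding congruence_def using assms
  by (intro conjI equivI allI impI refl_onI symI transI) blast+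

lemma congruenceD:
  assumes "congruence d R"
  shows "R \<subseteq> nvec d \<times> nvec d"
    and "z \<in> nvec d \<Longrightarrow> (z, z) \<in> R"
    and "(y, z) \<in> R \<Longrightarrow> (z, y) \<in> R"
    and "(x, y) \<in> R \<Longrightarrow> (y, z) \<in> R \<Longrightarrow> (x, z) \<in> R"
    and "(z, z') \<in> R \<Longrightarrow> w \<in> nvec d \<Longrightarrow> (nvec_add z w, nvec_add z' w) \<in> R"
  using assms unfolding congruence_def
  by (auto elim!: equivE dest: refl_onD symD transD)

lemma generates_congruence_mono:
  "generates_congruence d \<sigma> R \<Longrightarrow> \<sigma> \<subseteq> \<tau> \<Longrightarrow> \<tau> \<subseteq> R \<Longrightarrow> generates_congruence d \<tau> R"
  unfolding generates_congruence_def by blast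

text \<open>Generation is monotone among subsets of \<open>R\<close>, so single deletions decide
  about all proper subsets.\<close>

lemma minimally_generates_congruenceI:
  assumes "generates_congruence d \<sigma> R"
    and "\<And>e. e \<in> \<sigma> \<Longrightarrow> \<not> generates_congruence d (\<sigma> - {e}) R"
  shows "minimally_generates_congruence d \<sigma> R"
  unfolding minimally_generates_congruence_def
proof (intro conjI allI impI notI)
  fix \<sigma>' assume "\<sigma>' \<subset> \<sigma>" and gen: "generates_congruence d \<sigma>' R"
  then obtain e where "e \<in> \<sigma>" "\<sigma>' \<subseteq> \<sigma> - {e}" by blast
  moreover have "\<sigma> \<subseteq> R" using assms(1) by (simp add: generates_congruence_def)
  ultimately show False using assms(2) generates_congruence_mono[OF gen] by blast
qed (rule assms(1))

text \<open>Only the supplement is thinned out; \<open>\<rho>\<close> is kept whole and may be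
  infinite. Since \<open>T\<close> is finite, deleting a pair lowers the cardinality, against the
  choice of a least \<open>\<tau>\<close>.\<close>

lemma minimal_finite_supplement:
  assumes "finite T" "generates_congruence d (\<rho> \<union> T) R"
  obtains \<tau> where "\<tau> \<subseteq> T" "generates_congruence d (\<rho> \<union> \<tau>) R"
    "\<And>e. e \<in> \<tau> \<Longrightarrow> \<not> generates_congruence d (\<rho> \<union> (\<tau> - {e})) R"
proof -
  let ?P = "\<lambda>\<tau>. \<tau> \<subseteq> T \<and> generates_congruence d (\<rho> \<union> \<tau>) R"
  have "?P T" using assms(2) by simp
  from ex_has_least_nat[of ?P, OF this, of card]
  obtain \<tau> where \<tau>: "?P \<tau>" and least: "\<And>\<upsilon>. ?P \<upsilon> \<Longrightarrow> card \<tau> \<le> card \<upsilon>" by blast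
  have "\<not> generates_congruence d (\<rho> \<union> (\<tau> - {e})) R" if "e \<in> \<tau>" for e
  proof
    assume "generates_congruence d (\<rho> \<union> (\<tau> - {e})) R"
    with \<tau> have "card \<tau> \<le> card (\<tau> - {e})" by (intro least) auto
    moreover have "finite \<tau>" using \<tau> assms(1) finite_subset by blast
    ultimately show False using that card_Diff1_less[of \<tau> e] by simp
  qed
  with \<tau> that show thesis by blast
qed


section \<open>Values in the Kunz nilsemigroup\<close>

text \<open>The quotient map of \<open>S\<close> that collapses the ideal of non-Apery elements to
  infinity; numbers outside \<open>S\<close> are sent to infinity as well.\<close>

definition kunz_class :: "nat set \<Rightarrow> nat \<Rightarrow> nat \<Rightarrow> nat option" where
  "kunz_class S m x = (if x \<in> apery S m then Some (x mod m) else None)"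

lemma kunz_class_eq_None [simp]: "kunz_class S m x = None \<longleftrightarrow> x \<notin> apery S m"
  by (simp add: kunz_class_def)

context
  fixes S :: "nat set" and m :: nat
  assumes S: "numerical_semigroup S" and m_def: "m = smallest_positive S"
begin

lemma apery_elem_mod: "x \<in> apery S m \<Longrightarrow> apery_elem S m (x mod m) = x"
  by (rule apery_elem_eqI[OF S m_def]) auto

lemma in_apery_iff: "x \<in> apery S m \<longleftrightarrow> apery_elem S m (x mod m) = x"
  using apery_elem_mod apery_elem(1)[OF S m_def] by metis

lemma kunz_class_eq_Some:
  "i < m \<Longrightarrow> kunz_class S m x = Some i \<longleftrightarrow> x = apery_elem S m i"
  using apery_elem[OF S m_def, of i] apery_elem_mod[of x]
  by (auto simp: kunz_class_def)

text \<open>Equality with a finite value makes \<open>y\<close> Apery too, and an Apery element is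
  determined by its residue.\<close>

lemma kunz_class_eqD:
  "kunz_class S m x = kunz_class S m y \<Longrightarrow> x \<in> apery S m \<Longrightarrow> x = y"
  using apery_elem_mod by (metis kunz_class_def option.distinct(1) option.inject)

text \<open>For Apery \<open>x\<close> and \<open>y\<close>, the test in \<open>kunz_add\<close>
  says exactly that \<open>x + y\<close> is Apery again. Otherwise the sum is not Apery, since
  summands from \<open>S\<close> of an Apery element are Apery.\<close>

lemma kunz_class_add:
  assumes "x \<in> S" "y \<in> S"
  shows "kunz_class S m (x + y) = kunz_add S m (kunz_class S m x) (kunz_class S m y)"
proof (cases "x \<in> apery S m \<and> y \<in> apery S m")
  case True
  then show ?thesis
    by (simp add: kunz_class_def apery_elem_mod in_apery_iff[of "x + y"] mod_add_eq)
next
  case False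
  then have "x + y \<notin> apery S m"
    using apery_summand[OF S m_def, of x y] apery_summand[OF S m_def, of y x] assms
    by (auto simp: add.commute)
  then show ?thesis
    using False by (cases "kunz_class S m x") (auto simp: kunz_class_def)
qed

lemma kunz_class_zero: "kunz_class S m 0 = Some 0"
  using zero_in_apery[OF S m_def] by (simp add: kunz_class_def)

lemma S_mult: "x \<in> S \<Longrightarrow> c * x \<in> S"
  using S_add[OF S m_def] S_zero[OF S m_def] by (induction c) auto

lemma kunz_class_in_carrier: "kunz_class S m x \<in> carrier (kunz_nilsemigroup S m)"
  using m_pos[OF S m_def] by (auto simp: kunz_class_def kunz_nilsemigroup_def)

lemma kunz_class_mult:
  assumes "x \<in> S"
  shows "kunz_class S m (c * x) = kunz_class S m x [^]\<^bsub>kunz_nilsemigroup S m\<^esub> c"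
proof (induction c)
  case 0
  then show ?case by (simp add: kunz_class_zero) (simp add: kunz_nilsemigroup_def)
next
  case (Suc c)
  interpret comm_monoid "kunz_nilsemigroup S m" by (rule comm_monoid_kunz[OF S m_def])
  have "kunz_class S m (Suc c * x) = kunz_class S m (c * x + x)" by (simp add: add.commute)
  also have "\<dots> = kunz_add S m (kunz_class S m (c * x)) (kunz_class S m x)"
    by (rule kunz_class_add[OF S_mult[OF assms] assms])
  finally show ?case by (simp add: Suc) (simp add: kunz_nilsemigroup_def)
qed

text \<open>Membership of the sum in \<open>S\<close> is carried through the induction because
  additivity of \<open>kunz_class\<close> holds for elements of \<open>S\<close>.\<close>

lemma kunz_class_sum:
  assumes "finite A" "\<And>i. i \<in> A \<Longrightarrow> f i \<in> S"
  shows "sum f A \<in> S \<and> kunz_class S m (sum f A)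
           = finprod (kunz_nilsemigroup S m) (\<lambda>i. kunz_class S m (f i)) A"
  using assms
proof (induction rule: finite_induct)
  case empty
  interpret comm_monoid "kunz_nilsemigroup S m" by (rule comm_monoid_kunz[OF S m_def])
  show ?case
    using S_zero[OF S m_def] by (simp add: kunz_class_zero) (simp add: kunz_nilsemigroup_def)
next
  case (insert a A)
  interpret comm_monoid "kunz_nilsemigroup S m" by (rule comm_monoid_kunz[OF S m_def])
  have "finprod (kunz_nilsemigroup S m) (\<lambda>i. kunz_class S m (f i)) (insert a A)
      = kunz_add S m (kunz_class S m (f a)) (kunz_class S m (sum f A))"
    using insert kunz_class_in_carrier
    by (subst finprod_insert) (auto simp: kunz_nilsemigroup_def)
  then show ?case
    using insert S_add[OF S m_def] by (simp add: kunz_class_add)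
qed

section \<open>Factorizations into nonzero Apery elements\<close>

context
  fixes ns :: "nat list"
  assumes ns_irr: "set ns \<subseteq> apery S m - {0}"
begin

lemma ns_in_S: "i < length ns \<Longrightarrow> ns ! i \<in> S"
  using ns_irr by (auto simp: apery_def dest: nth_mem)

lemma phi_S_in_S: "phi_S ns z \<in> S"
  unfolding phi_S_def using ns_in_S by (intro conjunct1[OF kunz_class_sum] S_mult) auto

text \<open>Each generator is Apery, so its residue is its image under \<open>kunz_class\<close>;
  the homomorphism property does the rest.\<close>

lemma phi_P_eq: "phi_P S m (map (\<lambda>n. n mod m) ns) z = kunz_class S m (phi_S ns z)"
proof -
  interpret comm_monoid "kunz_nilsemigroup S m" by (rule comm_monoid_kunz[OF S m_def])
  have "kunz_class S m (phi_S ns z)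
      = finprod (kunz_nilsemigroup S m) (\<lambda>i. kunz_class S m (z ! i * ns ! i)) {..<length ns}"
    unfolding phi_S_def using ns_in_S by (intro conjunct2[OF kunz_class_sum] S_mult) auto
  also have "\<dots> = phi_P S m (map (\<lambda>n. n mod m) ns) z"
    unfolding phi_P_def
  proof (rule finprod_cong')
    fix i assume "i \<in> {..<length (map (\<lambda>n. n mod m) ns)}"
    then have i: "i < length ns" by simp
    then have "ns ! i \<in> apery S m" using ns_irr nth_mem by blast
    then show "kunz_class S m (z ! i * ns ! i)
        = Some (map (\<lambda>n. n mod m) ns ! i) [^]\<^bsub>kunz_nilsemigroup S m\<^esub> (z ! i)"
      using i by (simp add: kunz_class_mult ns_in_S) (simp add: kunz_class_def)
  next
    have "Some (n mod m) \<in> carrier (kunz_nilsemigroup S m)" for n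
      using m_pos[OF S m_def] by (simp add: kunz_nilsemigroup_def)
    then show "(\<lambda>i. Some (map (\<lambda>n. n mod m) ns ! i) [^]\<^bsub>kunz_nilsemigroup S m\<^esub> (z ! i))
        \<in> {..<length (map (\<lambda>n. n mod m) ns)} \<rightarrow> carrier (kunz_nilsemigroup S m)"
      by auto
  qed simp
  finally show ?thesis by simp
qed

text \<open>If \<open>c\<close> were positive, taking away one \<open>m\<close> would leave
  \<open>(c - 1) * m + x\<close>, which is still in \<open>S\<close>.\<close>

lemma add_mult_in_apery_imp_zero: "c * m + x \<in> apery S m \<Longrightarrow> x \<in> S \<Longrightarrow> c = 0"
  using S_add_mult[OF S m_def, of x "c - 1"] by (cases c) (auto simp: apery_def algebra_simps)

lemma factorizations_S_apery:
  assumes "i < m"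
  shows "factorizations_S (m # ns) (apery_elem S m i)
       = {0 # z | z. z \<in> factorizations_P S m (map (\<lambda>n. n mod m) ns) (Some i)}"
proof (intro equalityI subsetI)
  fix z assume "z \<in> factorizations_S (m # ns) (apery_elem S m i)"
  then obtain c y where z: "z = c # y" "y \<in> nvec (length ns)" "apery_elem S m i = c * m + phi_S ns y"
    by (auto simp: factorizations_S_def elim!: nvec_SucE)
  then have "c = 0"
    using add_mult_in_apery_imp_zero phi_S_in_S apery_elem(1)[OF S m_def, of i] by metis
  with z show "z \<in> {0 # z | z. z \<in> factorizations_P S m (map (\<lambda>n. n mod m) ns) (Some i)}"
    using assms by (simp add: factorizations_P_def phi_P_eq kunz_class_eq_Some)
qed (use assms in \<open>auto simp: factorizations_P_def factorizations_S_def phi_P_eq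
        kunz_class_eq_Some nvec_def\<close>)


section \<open>The presentation of the Kunz poset\<close>

abbreviation ker_P where "ker_P \<equiv> kernel (length ns) (phi_P S m (map (\<lambda>n. n mod m) ns))"

lemma ker_P_iff: "(y, y') \<in> ker_P \<longleftrightarrow> y \<in> nvec (length ns) \<and> y' \<in> nvec (length ns) \<and>
    kunz_class S m (phi_S ns y) = kunz_class S m (phi_S ns y')"
  by (simp add: kernel_def phi_P_eq)

lemma congruence_ker_P: "congruence (length ns) ker_P"
  by (rule congruenceI) (auto simp: ker_P_iff phi_S_add kunz_class_add phi_S_in_S)

text \<open>A finite stock of vectors of the nil class. The descent below reaches entries at most
  \<open>m\<close>; the bound is one larger so that such a vector plus a unit vector still lies in
  the box.\<close>

definition nil_box :: "nat list set" where
  "nil_box = {z \<in> nvec (length ns). phi_S ns z \<notin> apery S m \<and> set z \<subseteq> {..Suc m}}"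

lemma finite_nil_box: "finite nil_box"
  by (rule finite_subset[OF _ finite_lists_length_eq[of "{..Suc m}" "length ns"]])
    (auto simp: nil_box_def nvec_def)

text \<open>Here \<open>m\<close> copies of \<open>ns ! i\<close> are traded for
  \<open>ns ! i\<close> copies of \<open>m\<close>. As \<open>ns ! i\<close> is positive, the value
  minus \<open>m\<close> stays in \<open>S\<close>.\<close>

lemma phi_S_notin_apery:
  assumes "i < length ns" "m \<le> z ! i"
  shows "phi_S ns z \<notin> apery S m"
proof
  assume "phi_S ns z \<in> apery S m"
  define r where "r = (\<Sum>j\<in>{..<length ns} - {i}. z ! j * ns ! j)"
  obtain t where t: "z ! i = m + t" using assms(2) le_iff_add by blast
  have "phi_S ns z = z ! i * ns ! i + r"
    using assms(1) by (simp add: phi_S_def r_def sum.remove[of _ i])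
  then have "phi_S ns z = ns ! i * m + (t * ns ! i + r)"
    by (simp add: t algebra_simps)
  moreover have "t * ns ! i + r \<in> S"
    unfolding r_def using assms(1) ns_in_S
    by (intro S_add[OF S m_def] S_mult conjunct1[OF kunz_class_sum]) auto
  ultimately have "ns ! i = 0"
    using add_mult_in_apery_imp_zero[of "ns ! i"] \<open>phi_S ns z \<in> apery S m\<close> by simp
  then show False using ns_irr nth_mem[OF assms(1)] by auto
qed

text \<open>A vector of the nil class with an entry above \<open>m\<close> stays in the class when that entry
  is lowered by one, so the relations in the box suffice to descend to entries at most \<open>m\<close>.\<close>

lemma nil_box_generates:
  assumes R: "congruence (length ns) R" and box: "nil_box \<times> nil_box \<subseteq> R"
    and z: "z \<in> nvec (length ns)" "phi_S ns z \<notin> apery S m"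
  shows "\<exists>b\<in>nil_box. set b \<subseteq> {..m} \<and> (z, b) \<in> R"
  using z
proof (induction "sum_list z" arbitrary: z rule: less_induct)
  case less
  show ?case
  proof (cases "set z \<subseteq> {..m}")
    case True
    then have "z \<in> nil_box" using less.prems by (auto simp: nil_box_def)
    then show ?thesis using True congruenceD(2)[OF R less.prems(1)] by blast
  next
    case False
    then obtain x where "x \<in> set z" "\<not> x \<le> m" by auto
    then obtain i where i: "i < length ns" "m < z ! i"
      using less.prems(1) by (auto simp: nvec_def in_set_conv_nth not_le)
    define y where "y = z[i := z ! i - 1]"
    define e where "e = (replicate (length ns) 0)[i := (1::nat)]"
    have e: "e \<in> nvec (length ns)" and y: "y \<in> nvec (length ns)"
      using less.prems(1) by (auto simp: e_def y_def nvec_def)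
    have z_eq: "z = nvec_add y e"
      using i less.prems(1)
      by (auto intro!: nth_equalityI simp: y_def e_def nvec_def nvec_add_def nth_list_update)
    have "sum_list y < sum_list z"
      using i less.prems(1) elem_le_sum_list[of i z] by (simp add: y_def nvec_def sum_list_update)
    \<comment> \<open>The lowered entry exceeded \<open>m\<close>, so it is still at least
      \<open>m\<close>.\<close>
    moreover have "phi_S ns y \<notin> apery S m"
      using i less.prems(1) by (intro phi_S_notin_apery[OF i(1)]) (auto simp: y_def nvec_def)
    ultimately obtain b where b: "b \<in> nil_box" "set b \<subseteq> {..m}" "(y, b) \<in> R"
      using less.hyps y by blast
    have "nvec_add b e \<in> nil_box"
      unfolding nil_box_def
    proof (intro CollectI conjI)
      show "nvec_add b e \<in> nvec (length ns)" using b(1) e by (simp add: nil_box_def)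
      show "phi_S ns (nvec_add b e) \<notin> apery S m"
        using apery_summand[OF S m_def _ phi_S_in_S phi_S_in_S] b(1) e
        by (auto simp: nil_box_def phi_S_add)
      show "set (nvec_add b e) \<subseteq> {..Suc m}"
      proof
        fix x assume "x \<in> set (nvec_add b e)"
        then obtain u v where "u \<in> set b" "v \<in> set e" "x = u + v"
          unfolding nvec_add_def by (auto dest: set_zip_leftD set_zip_rightD)
        moreover have "v \<le> 1"
          using \<open>v \<in> set e\<close> set_update_subset_insert[of "replicate (length ns) 0" i "1::nat"]
          by (fastforce simp: e_def set_replicate_conv_if split: if_splits)
        ultimately show "x \<in> {..Suc m}" using b(2) by fastforce
      qed
    qed
    \<comment> \<open>Both vectors lie in the box, so \<open>z\<close>, which is \<open>y\<close>
      plus \<open>e\<close>, is related to \<open>b\<close> plus \<open>e\<close> and from there to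
      \<open>b\<close>, whose entries are again at most \<open>m\<close>.\<close>
    then have "(nvec_add b e, b) \<in> R" using b(1) box by blast
    moreover have "(z, nvec_add b e) \<in> R"
      unfolding z_eq by (rule congruenceD(5)[OF R b(3) e])
    ultimately show ?thesis using b congruenceD(4)[OF R] by blast
  qed
qed

section \<open>The Apery part of a minimal presentation\<close>

context
  fixes \<rho> :: "(nat list \<times> nat list) set"
  assumes \<rho>: "minimal_presentation_S (m # ns) \<rho>"
begin

abbreviation ker_S where "ker_S \<equiv> kernel (Suc (length ns)) (phi_S (m # ns))"

definition apery_part :: "(nat list \<times> nat list) set" where
  "apery_part = {(tl z, tl z') | z z'. (z, z') \<in> \<rho> \<and> phi_S (m # ns) z \<in> apery S m}"

lemma \<rho>_gen: "\<rho> \<subseteq> ker_S" "\<And>R. congruence (Suc (length ns)) R \<Longrightarrow> \<rho> \<subseteq> R \<Longrightarrow> ker_S \<subseteq> R"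
  and congruence_ker_S: "congruence (Suc (length ns)) ker_S"
  and \<rho>_min: "e \<in> \<rho> \<Longrightarrow> \<not> generates_congruence (Suc (length ns)) (\<rho> - {e}) ker_S"
  using \<rho> unfolding minimal_presentation_S_def minimally_generates_congruence_def
    generates_congruence_def by auto

text \<open>Both sides factor the same Apery element, so neither uses \<open>m\<close>, and dropping
  the first coordinates loses nothing.\<close>

lemma ker_S_apery:
  assumes "(z, z') \<in> ker_S" "phi_S (m # ns) z \<in> apery S m"
  obtains y y' where "z = 0 # y" "z' = 0 # y'" "(y, y') \<in> ker_P" "phi_S ns y \<in> apery S m"
proof -
  obtain c y c' y' where z: "z = c # y" "z' = c' # y'" "y \<in> nvec (length ns)" "y' \<in> nvec (length ns)"
    using assms(1) by (auto simp: kernel_def elim!: nvec_SucE)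
  have "c * m + phi_S ns y \<in> apery S m" and eq: "c * m + phi_S ns y = c' * m + phi_S ns y'"
    using assms z by (auto simp: kernel_def)
  then have "c = 0" "c' = 0"
    using add_mult_in_apery_imp_zero phi_S_in_S by metis+
  then show thesis using that[of y y'] z eq assms(2) by (simp add: ker_P_iff)
qed

lemma apery_part_iff:
  "(y, y') \<in> apery_part \<longleftrightarrow> (0 # y, 0 # y') \<in> \<rho> \<and> phi_S ns y \<in> apery S m"
proof
  assume "(y, y') \<in> apery_part"
  then obtain z z' where z: "(z, z') \<in> \<rho>" "phi_S (m # ns) z \<in> apery S m" "y = tl z" "y' = tl z'"
    by (auto simp: apery_part_def)
  then show "(0 # y, 0 # y') \<in> \<rho> \<and> phi_S ns y \<in> apery S m"
    using \<rho>_gen(1) ker_S_apery[of z z'] by (metis list.sel(3) subsetD)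
next
  assume "(0 # y, 0 # y') \<in> \<rho> \<and> phi_S ns y \<in> apery S m"
  then show "(y, y') \<in> apery_part"
    unfolding apery_part_def by (intro CollectI exI[of _ "0 # y"] exI[of _ "0 # y'"]) auto
qed

lemma apery_part_subset: "apery_part \<subseteq> ker_P"
proof clarify
  fix y y' assume "(y, y') \<in> apery_part"
  then have "(0 # y, 0 # y') \<in> ker_S" "phi_S (m # ns) (0 # y) \<in> apery S m"
    using \<rho>_gen(1) by (auto simp: apery_part_iff)
  then show "(y, y') \<in> ker_P" by (rule ker_S_apery) auto
qed

text \<open>A congruence \<open>R\<close> on the shorter vectors is lifted to a congruence
  \<open>C\<close> containing \<open>\<rho>\<close>, hence all of \<open>ker_S\<close>. Read on
  vectors with first entry 0, this puts the Apery pairs of \<open>ker_P\<close> into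
  \<open>R\<close>; the box relations supply the nil class.\<close>

lemma apery_part_generates: "generates_congruence (length ns) (apery_part \<union> nil_box \<times> nil_box) ker_P"
  unfolding generates_congruence_def
proof (intro conjI allI impI)
  show "apery_part \<union> nil_box \<times> nil_box \<subseteq> ker_P"
    using apery_part_subset by (auto simp: nil_box_def ker_P_iff kunz_class_def)
  fix R assume "congruence (length ns) R \<and> apery_part \<union> nil_box \<times> nil_box \<subseteq> R"
  then have R: "congruence (length ns) R" and sub: "apery_part \<subseteq> R" "nil_box \<times> nil_box \<subseteq> R"
    by auto
  \<comment> \<open>Only pairs with Apery value are constrained, so \<open>\<rho>\<close> lies in
    \<open>C\<close> as soon as its Apery part lies in \<open>R\<close>.\<close>
  define C where "C = {(z, z') \<in> ker_S. phi_S (m # ns) z \<in> apery S m \<longrightarrow> (tl z, tl z') \<in> R}"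
  note ker_S_D = congruenceD[OF congruence_ker_S]
  have ker_S_phi: "phi_S (m # ns) z = phi_S (m # ns) z'" if "(z, z') \<in> ker_S" for z z'
    using that by (simp add: kernel_def)
  have "congruence (Suc (length ns)) C"
  proof (rule congruenceI)
    show "C \<subseteq> nvec (Suc (length ns)) \<times> nvec (Suc (length ns))"
      using ker_S_D(1) by (auto simp: C_def)
    show "(z, z) \<in> C" if "z \<in> nvec (Suc (length ns))" for z
      using ker_S_D(2)[OF that] congruenceD(2)[OF R] that by (auto simp: C_def elim!: nvec_SucE)
    show "(z, y) \<in> C" if "(y, z) \<in> C" for y z
      using that ker_S_D(3) congruenceD(3)[OF R] ker_S_phi[of y z] by (auto simp: C_def)
    show "(x, z) \<in> C" if "(x, y) \<in> C" "(y, z) \<in> C" for x y z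
      using that ker_S_D(4)[of x y z] congruenceD(4)[OF R] ker_S_phi[of x y] by (auto simp: C_def)
    show "(nvec_add z w, nvec_add z' w) \<in> C"
      if zC: "(z, z') \<in> C" and w: "w \<in> nvec (Suc (length ns))" for z z' w
    proof -
      have zz: "(z, z') \<in> ker_S" using zC by (simp add: C_def)
      obtain c y c' y' d v where eqs: "z = c # y" "z' = c' # y'" "w = d # v"
        "y \<in> nvec (length ns)" "y' \<in> nvec (length ns)" "v \<in> nvec (length ns)"
        using zz w by (auto simp: kernel_def elim!: nvec_SucE)
      \<comment> \<open>If the translated value is Apery, so is the value of its summand
        \<open>z\<close>; hence membership of \<open>(z, z')\<close> in \<open>C\<close> already
        relates the tails in \<open>R\<close>.\<close>
      have "(nvec_add y v, nvec_add y' v) \<in> R" if *: "phi_S (m # ns) (nvec_add z w) \<in> apery S m"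
      proof -
        have "phi_S (m # ns) z + phi_S (m # ns) w \<in> apery S m"
          using * eqs by (simp add: phi_S_add algebra_simps)
        moreover have "phi_S (m # ns) z \<in> S" "phi_S (m # ns) w \<in> S"
          using eqs phi_S_in_S S_add[OF S m_def] S_mult[OF m_in[OF S m_def]] by auto
        ultimately have "phi_S (m # ns) z \<in> apery S m" by (rule apery_summand[OF S m_def])
        then have "(y, y') \<in> R" using zC eqs by (auto simp: C_def)
        then show ?thesis using congruenceD(5)[OF R] eqs by blast
      qed
      then show ?thesis using ker_S_D(5)[OF zz w] eqs by (simp add: C_def)
    qed
  qed
  moreover have "\<rho> \<subseteq> C"
    using \<rho>_gen(1) sub(1) by (auto simp: C_def apery_part_def)
  ultimately have ker_S_C: "ker_S \<subseteq> C" by (rule \<rho>_gen(2))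
  show "ker_P \<subseteq> R"
  proof clarify
    fix y y' assume "(y, y') \<in> ker_P"
    then have y: "y \<in> nvec (length ns)" "y' \<in> nvec (length ns)"
      and eq: "kunz_class S m (phi_S ns y) = kunz_class S m (phi_S ns y')"
      by (auto simp: ker_P_iff)
    show "(y, y') \<in> R"
    proof (cases "phi_S ns y \<in> apery S m")
      case True
      then have "(0 # y, 0 # y') \<in> ker_S"
        using y kunz_class_eqD[OF eq] by (simp add: kernel_def nvec_def)
      then show ?thesis using ker_S_C True by (auto simp: C_def)
    next
      case False
      \<comment> \<open>Both vectors descend into the box, where any two vectors are
        related.\<close>
      then have "phi_S ns y' \<notin> apery S m" using eq by (metis kunz_class_eq_None)
      with False obtain b b' where "b \<in> nil_box" "(y, b) \<in> R" "b' \<in> nil_box" "(y', b') \<in> R"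
        using nil_box_generates[OF R sub(2)] y by meson
      then show ?thesis using sub(2) congruenceD(3,4)[OF R] by blast
    qed
  qed
qed (rule congruence_ker_P)

text \<open>The transport runs the other way: if the remaining pairs still generated
  \<open>ker_P\<close>, every congruence containing \<open>\<rho>\<close> without the lifted pair
  would recover that pair, against the minimality of \<open>\<rho>\<close>.\<close>

lemma apery_part_irredundant:
  assumes "(x, x') \<in> apery_part" "\<tau> \<subseteq> nil_box \<times> nil_box"
  shows "\<not> generates_congruence (length ns) (apery_part \<union> \<tau> - {(x, x')}) ker_P"
proof
  assume gen: "generates_congruence (length ns) (apery_part \<union> \<tau> - {(x, x')}) ker_P"
  let ?e = "(0 # x, 0 # x')"
  have x: "?e \<in> \<rho>" "phi_S ns x \<in> apery S m" using assms(1) by (auto simp: apery_part_iff)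
  have "generates_congruence (Suc (length ns)) (\<rho> - {?e}) ker_S"
    unfolding generates_congruence_def
  proof (intro conjI allI impI)
    show "\<rho> - {?e} \<subseteq> ker_S" using \<rho>_gen(1) by auto
    fix C assume "congruence (Suc (length ns)) C \<and> \<rho> - {?e} \<subseteq> C"
    then have C: "congruence (Suc (length ns)) C" and sub: "\<rho> - {?e} \<subseteq> C" by auto
    \<comment> \<open>The nil class is left unconstrained, so \<open>R\<close> contains
      \<open>\<tau>\<close> whatever \<open>C\<close> is; the surviving Apery pairs lie in
      \<open>R\<close> because their lifts survive in \<open>\<rho> - {?e}\<close>.\<close>
    define R where "R = {(y, y') \<in> ker_P. phi_S ns y \<in> apery S m \<longrightarrow> (0 # y, 0 # y') \<in> C}"
    note ker_P_D = congruenceD[OF congruence_ker_P]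
    have ker_P_apery: "phi_S ns y \<in> apery S m \<longleftrightarrow> phi_S ns y' \<in> apery S m" if "(y, y') \<in> ker_P" for y y'
      using that ker_P_iff kunz_class_eq_None by metis
    have "congruence (length ns) R"
    proof (rule congruenceI)
      show "R \<subseteq> nvec (length ns) \<times> nvec (length ns)"
        using ker_P_D(1) by (auto simp: R_def)
      show "(z, z) \<in> R" if "z \<in> nvec (length ns)" for z
        using ker_P_D(2)[OF that] congruenceD(2)[OF C, of "0 # z"] that by (auto simp: R_def nvec_def)
      show "(z, y) \<in> R" if "(y, z) \<in> R" for y z
        using that ker_P_D(3) congruenceD(3)[OF C] ker_P_apery[of y z] by (auto simp: R_def)
      show "(x, z) \<in> R" if "(x, y) \<in> R" "(y, z) \<in> R" for x y z
        using that ker_P_D(4)[of x y z] congruenceD(4)[OF C] ker_P_apery[of x y] by (auto simp: R_def)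
      show "(nvec_add z w, nvec_add z' w) \<in> R"
        if zR: "(z, z') \<in> R" and w: "w \<in> nvec (length ns)" for z z' w
      proof -
        have zz: "(z, z') \<in> ker_P" using zR by (simp add: R_def)
        then have z: "z \<in> nvec (length ns)" by (simp add: ker_P_iff)
        have "(0 # nvec_add z w, 0 # nvec_add z' w) \<in> C"
          if "phi_S ns (nvec_add z w) \<in> apery S m"
        proof -
          have "phi_S ns z \<in> apery S m"
            using that z w apery_summand[OF S m_def _ phi_S_in_S phi_S_in_S]
            by (auto simp: phi_S_add)
          then have "(0 # z, 0 # z') \<in> C" using zR by (auto simp: R_def)
          moreover have "0 # w \<in> nvec (Suc (length ns))" using w by (simp add: nvec_def)
          ultimately show ?thesis using congruenceD(5)[OF C] by fastforce
        qed
        then show ?thesis using ker_P_D(5)[OF zz w] by (simp add: R_def)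
      qed
    qed
    moreover have "apery_part \<union> \<tau> - {(x, x')} \<subseteq> R"
    proof (rule subrelI)
      fix y y' assume y: "(y, y') \<in> apery_part \<union> \<tau> - {(x, x')}"
      then consider "(y, y') \<in> apery_part" | "(y, y') \<in> nil_box \<times> nil_box"
        using assms(2) by blast
      then show "(y, y') \<in> R"
      proof cases
        case 1
        then show ?thesis using y sub apery_part_subset by (auto simp: R_def apery_part_iff)
      next
        case 2
        then show ?thesis by (auto simp: R_def nil_box_def ker_P_iff kunz_class_def)
      qed
    qed
    ultimately have "ker_P \<subseteq> R" using gen by (simp add: generates_congruence_def)
    \<comment> \<open>The deleted pair lies in \<open>ker_P\<close> and has Apery value, so its
      membership in \<open>R\<close> forces its lift into \<open>C\<close>.\<close>
    then have "?e \<in> C" using assms(1) apery_part_subset x(2) by (auto simp: R_def)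
    then have "\<rho> \<subseteq> C" using sub by auto
    then show "ker_S \<subseteq> C" by (rule \<rho>_gen(2)[OF C])
  qed (rule congruence_ker_S)
  then show False using \<rho>_min[OF x(1)] by simp
qed

lemma minimal_presentation_P_apery_part:
  "minimal_presentation_P S m (map (\<lambda>n. n mod m) ns) apery_part"
proof -
  obtain \<tau> where \<tau>: "\<tau> \<subseteq> nil_box \<times> nil_box" "generates_congruence (length ns) (apery_part \<union> \<tau>) ker_P"
    "\<And>e. e \<in> \<tau> \<Longrightarrow> \<not> generates_congruence (length ns) (apery_part \<union> (\<tau> - {e})) ker_P"
    using minimal_finite_supplement[OF _ apery_part_generates] finite_nil_box by blast
  \<comment> \<open>The values are Apery on one side and not on the other, so deleting a pair of
    \<open>\<tau>\<close> leaves \<open>apery_part\<close> intact.\<close>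
  have disj: "apery_part \<inter> \<tau> = {}"
    using \<tau>(1) by (auto simp: apery_part_iff nil_box_def)
  have "minimally_generates_congruence (length ns) (apery_part \<union> \<tau>) ker_P"
  proof (rule minimally_generates_congruenceI[OF \<tau>(2)])
    fix e assume "e \<in> apery_part \<union> \<tau>"
    then show "\<not> generates_congruence (length ns) (apery_part \<union> \<tau> - {e}) ker_P"
    proof
      assume "e \<in> apery_part"
      then show ?thesis using apery_part_irredundant[OF _ \<tau>(1)] by (cases e) auto
    next
      assume "e \<in> \<tau>"
      then have "apery_part \<union> \<tau> - {e} = apery_part \<union> (\<tau> - {e})" using disj by auto
      then show ?thesis using \<tau>(3)[OF \<open>e \<in> \<tau>\<close>] by simp
    qed
  qed
  \<comment> \<open>All pairs of \<open>\<tau>\<close> have value infinity and are exactly the ones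
    deleted.\<close>
  moreover have "apery_part
      = {(z, z') \<in> apery_part \<union> \<tau>. phi_P S m (map (\<lambda>n. n mod m) ns) z \<noteq> None}"
    using \<tau>(1) by (auto simp: phi_P_eq apery_part_iff nil_box_def)
  ultimately show ?thesis unfolding minimal_presentation_P_def length_map by blast
qed

end

end

text \<open>If \<open>n - m\<close> were in \<open>S\<close>, then \<open>n = m + (n - m)\<close>
  would split an irreducible element into two nonzero parts.\<close>

lemma minimal_generators_in_apery:
  assumes "minimal_generators G S" "n \<in> G" "n \<noteq> m"
  shows "n \<in> apery S m - {0}"
proof -
  have n: "n \<in> S" "0 < n" "\<And>x y. x \<in> S \<Longrightarrow> y \<in> S \<Longrightarrow> n = x + y \<Longrightarrow> x = 0 \<or> y = 0"
    using minimal_generators_iff[OF S m_def assms(1), of n] assms(2) by auto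
  then show ?thesis
    using n(3)[of m "n - m"] m_in[OF S m_def] m_pos[OF S m_def] assms(3) by (auto simp: apery_def)
qed

end

theorem theorem3p8:
  fixes S :: "nat set" and m :: nat and ns ps :: "nat list"
  assumes "numerical_semigroup S"
    and "m = smallest_positive S"
    and "sorted_wrt (<) (m # ns)"
    and "minimal_generators (set (m # ns)) S"
    and "ps = map (\<lambda>n. n mod m) ns"
  shows "(\<forall>i<m. factorizations_S (m # ns) (apery_elem S m i)
              = {0 # z | z. z \<in> factorizations_P S m ps (Some i)})
       \<and> (\<forall>\<rho>. minimal_presentation_S (m # ns) \<rho> \<longrightarrow>
            minimal_presentation_P S m ps
              {(tl z, tl z') | z z'. (z, z') \<in> \<rho> \<and> phi_S (m # ns) z \<in> apery S m})"
proof -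
  \<comment> \<open>Strict sortedness keeps \<open>m\<close> itself out of
    \<open>ns\<close>.\<close>
  have "set ns \<subseteq> apery S m - {0}"
    using minimal_generators_in_apery[OF assms(1,2,4)] assms(3) by auto
  note ctxt = assms(1,2) this
  show ?thesis
    unfolding assms(5)
    using factorizations_S_apery[OF ctxt] minimal_presentation_P_apery_part[OF ctxt]
    by (simp add: apery_part_def[OF ctxt])
qed

end
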